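(* Let $(X,\mathcal{S})$ be an $S$-metric space, let $x_0\in X$, $r\in(0,\infty)$, and let $C_{x_0,r}^{S}$ be the circle centered at $x_0$ with radius $r$. Define $\varphi:X\to[0,\infty)$ by $\varphi(x)=\mathcal{S}(x,x,x_0)$ for all $x\in X$. If $T:X\to X$ is a self-mapping satisfying $$\mathcal{S}(x,x,Tx)\leq \varphi(x)-\varphi(Tx)$$ and $$h\,\mathcal{S}(x,x,Tx)+\mathcal{S}(Tx,Tx,x_0)\geq r$$ for all $x\in C_{x_0,r}^{S}$ and some $h\in[0,1)$, then $C_{x_0,r}^{S}$ is a fixed circle of $T$.
   Context: An $S$-metric on a nonempty set $X$ is a function $\mathcal{S}:X^3\to[0,\infty)$ such that for all $x,y,z,a\in X$: (1) $\mathcal{S}(x,y,z)=0$ if and only if $x=y=z$; (2) $\mathcal{S}(x,y,z)\leq \mathcal{S}(x,x,a)+\mathcal{S}(y,y,a)+\mathcal{S}(z,z,a)$. The pair $(X,\mathcal{S})$ is then called an $S$-metric space. For $x_0\in X$ and $r\in(0,\infty)$, the circle centered at $x_0$ with radius $r$ is $C_{x_0,r}^{S}=\{x\in X:\mathcal{S}(x,x,x_0)=r\}$. For a self-mapping $T:X\to X$, the circle $C_{x_0,r}^{S}$ is said to be a fixed circle of $T$ if $Tx=x$ for all $x\in C_{x_0,r}^{S}$. *)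

theory Defs
  imports Complex_Main "HOL-Library.FuncSet"
begin

locale S_metric_space =
  fixes X :: "'a set" and S :: "'a \<Rightarrow> 'a \<Rightarrow> 'a \<Rightarrow> real"
  assumes nonempty: "X \<noteq> {}"
    and nonneg: "\<lbrakk>x \<in> X; y \<in> X; z \<in> X\<rbrakk> \<Longrightarrow> 0 \<le> S x y z"
    and zero_iff: "\<lbrakk>x \<in> X; y \<in> X; z \<in> X\<rbrakk> \<Longrightarrow> S x y z = 0 \<longleftrightarrow> x = y \<and> y = z"
    and triangle: "\<lbrakk>x \<in> X; y \<in> X; z \<in> X; a \<in> X\<rbrakk>
      \<Longrightarrow> S x y z \<le> S x x a + S y y a + S z z a"

definition S_circle :: "'a set \<Rightarrow> ('a \<Rightarrow> 'a \<Rightarrow> 'a \<Rightarrow> real) \<Rightarrow> 'a \<Rightarrow> real \<Rightarrow> 'a set" where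
  "S_circle X S x0 r = {x \<in> X. S x x x0 = r}"

definition fixed_circle ::
  "'a set \<Rightarrow> ('a \<Rightarrow> 'a \<Rightarrow> 'a \<Rightarrow> real) \<Rightarrow> ('a \<Rightarrow> 'a) \<Rightarrow> 'a \<Rightarrow> real \<Rightarrow> bool" where
  "fixed_circle X S T x0 r \<longleftrightarrow> (\<forall>x \<in> S_circle X S x0 r. T x = x)"

end

theory Submission
  imports Defs
begin

text \<open>On the circle the first inequality says that the displacement
  \<open>d = S x x (T x)\<close> is at most the amount \<open>r - S (T x) (T x) x0\<close> by which \<open>T\<close> moves
  \<open>x\<close> towards the centre; the second says that this amount is at most \<open>h * d\<close>.
  Hence \<open>d \<le> h * d\<close> with \<open>h < 1\<close>, which forces \<open>d = 0\<close>.\<close>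

theorem theorem3p2:
  fixes X :: "'a set" and S :: "'a \<Rightarrow> 'a \<Rightarrow> 'a \<Rightarrow> real"
    and x0 :: 'a and r :: real and \<phi> :: "'a \<Rightarrow> real" and T :: "'a \<Rightarrow> 'a"
  assumes "S_metric_space X S"
    and "x0 \<in> X" and "0 < r"
    and "\<forall>x\<in>X. \<phi> x = S x x x0"
    and "T \<in> X \<rightarrow> X"
    and "\<forall>x\<in>S_circle X S x0 r. S x x (T x) \<le> \<phi> x - \<phi> (T x)"
    and "\<exists>h::real. 0 \<le> h \<and> h < 1 \<and>
           (\<forall>x\<in>S_circle X S x0 r. h * S x x (T x) + S (T x) (T x) x0 \<ge> r)"
  shows "fixed_circle X S T x0 r"
  unfolding fixed_circle_def
proof
  interpret S_metric_space X S by fact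
  fix x assume x: "x \<in> S_circle X S x0 r"
  let ?d = "S x x (T x)"
  have xX: "x \<in> X" and on_circle: "S x x x0 = r"
    using x by (auto simp: S_circle_def)
  have TxX: "T x \<in> X"
    using xX assms(5) by blast
  obtain h where h: "h < 1" and outer: "r \<le> h * ?d + S (T x) (T x) x0"
    using assms(7) x by blast
  have inner: "?d \<le> r - S (T x) (T x) x0"
    using assms(4,6) x xX TxX on_circle by auto
  have "(1 - h) * ?d \<le> 0"
    using inner outer by (simp add: algebra_simps)
  then have "?d \<le> 0"
    using h by (simp add: mult_le_0_iff)
  then have "?d = 0"
    using nonneg[OF xX xX TxX] by simp
  then show "T x = x"
    using zero_iff[OF xX xX TxX] by simp
qed

end
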